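(* Let $N\geq 3$ be an integer. There exists $\delta>0$ such that if $p$ and $q$ are primes satisfying \[ \left|\frac{\log q}{\log p} - \frac{1+\sqrt5}{2}\right| < \delta, \] then $(p,q)$ is compatible with $N$.
   Context: $(h_k)_{k\geq 0}$ is the Fibonacci sequence with $h_0=0$, $h_1=1$, $h_{k+1}=h_k+h_{k-1}$. For a nonzero algebraic number $\alpha$ with minimal polynomial over $\mathbb Z$ equal to $a\prod_{i=1}^d(z-\alpha_i)$, $m(\alpha)=\log|a|+\sum_{i=1}^d\log\max\{1,|\alpha_i|\}$ (the logarithmic Mahler measure); for coprime nonzero integers $r,s$, $m(r/s)=\log\max\{|r|,|s|\}$. For primes $p,q$ satisfying $\frac{h_N}{h_{N-1}} < \frac{\log q}{\log p} < \frac{h_{N-1}}{h_{N-2}}$ or $\frac{h_{N-1}}{h_{N-2}} < \frac{\log q}{\log p} < \frac{h_N}{h_{N-1}}$ (call this condition (W)), and each integer $n\geq 3$, there is a unique positive real number $t_n$ with \[ m\left(\frac{p^{h_n}}{q^{h_{n-1}}}\right)^{t_n} = m\left(\frac{p^{h_{n-1}}}{q^{h_{n-2}}}\right)^{t_n} + m\left(\frac{p^{h_{n-2}}}{q^{h_{n-3}}}\right)^{t_n}. \] An ordered pair of primes $(p,q)$ is called compatible with $N$ if it satisfies (W) and $t_{N+1}<t_N<t_{N-1}<\cdots<t_4<t_3$. *)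

theory Defs
  imports
    "HOL-Real_Asymp.Real_Asymp"
    "HOL-Number_Theory.Fib"
    "HOL-Computational_Algebra.Computational_Algebra"
    "Berlekamp_Zassenhaus.Factor_Bound"
begin

text \<open>
  The minimal polynomial over the integers: the irreducible element of \<open>\<int>[z]\<close> vanishing at
  \<open>\<alpha>\<close>, normalised to have positive leading coefficient. Irreducibility in \<open>\<int>[z]\<close> (as opposed
  to \<open>\<rat>[z]\<close>) includes primitivity.
\<close>

definition min_int_poly :: "complex \<Rightarrow> int poly" where
  "min_int_poly \<alpha> =
     (THE f. irreducible f \<and> lead_coeff f > 0 \<and> poly (map_poly of_int f) \<alpha> = 0)"

lemma min_int_poly_ex1:
  assumes "algebraic \<alpha>"
  shows "\<exists>!f. irreducible f \<and> lead_coeff f > 0 \<and> poly (map_poly of_int f) (\<alpha>::complex) = 0"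
proof -
  let ?c = "\<lambda>f::int poly. poly (map_poly of_int f) \<alpha>"
  have uniq: "f dvd g" if f: "irreducible f" "?c f = 0" and g: "?c g = 0" for f g :: "int poly"
  proof (rule ccontr)
    assume "\<not> f dvd g"
    moreover have "gcd f g dvd f" by simp
    ultimately have "is_unit (gcd f g)"
      using f(1) by (meson gcd_dvd2 dvd_trans irreducibleD')
    then have "gcd f g = 1" by (simp add: is_unit_gcd)
    then have "gcd (of_int_poly f :: rat poly) (of_int_poly g) = 1"
      by (subst gcd_rat_to_gcd_int) simp
    then obtain u v where uv: "u * of_int_poly f + v * of_int_poly g = (1 :: rat poly)"
      by (metis bezout_coefficients_fst_snd)
    have of: "map_poly (of_rat :: rat \<Rightarrow> complex) (of_int_poly h) = of_int_poly h" for h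
      by (simp add: map_poly_map_poly o_def)
    interpret of_rat_poly_hom: map_poly_comm_semiring_hom "of_rat :: rat \<Rightarrow> complex" ..
    have hom: "map_poly (of_rat :: rat \<Rightarrow> complex) (a * of_int_poly f + b * of_int_poly g)
       = map_poly of_rat a * of_int_poly f + map_poly of_rat b * of_int_poly g" for a b
      by (simp only: of_rat_poly_hom.hom_add of_rat_poly_hom.hom_mult of)
    have "poly (map_poly of_rat (u * of_int_poly f + v * of_int_poly g)) \<alpha> = 0"
      unfolding hom using f(2) g by simp
    then show False unfolding uv by simp
  qed
  have "\<exists>f. irreducible f \<and> ?c f = 0"
  proof -
    obtain p where p: "\<And>i. Polynomial.coeff p i \<in> \<int>" "p \<noteq> 0" "poly p \<alpha> = 0"
      using assms by (rule algebraicE) blast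
    define P where "P = map_poly (\<lambda>z. \<lfloor>Re z\<rfloor>) p"
    have P: "p = of_int_poly P"
    proof (rule poly_eqI)
      fix i
      obtain k where "Polynomial.coeff p i = of_int k" using p(1)[of i] by (auto elim!: Ints_cases)
      then show "Polynomial.coeff p i = Polynomial.coeff (of_int_poly P) i"
        by (simp add: P_def coeff_map_poly)
    qed
    then have P0: "P \<noteq> 0" "?c P = 0" using p by auto
    have "\<exists>f\<in>#prime_factorization P. ?c f = 0"
    proof -
      have "P dvd prod_mset (prime_factorization P)"
        using prod_mset_prime_factorization_weak[OF P0(1)] by (metis dvd_normalize_iff dvd_refl)
      then have "?c (prod_mset (prime_factorization P)) = 0"
        using P0(2) by (auto elim!: dvdE simp: hom_distribs)
      moreover have "?c (prod_mset A) = 0 \<Longrightarrow> \<exists>f\<in>#A. ?c f = 0" for A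
        by (induction A) (auto simp: hom_distribs)
      ultimately show ?thesis by blast
    qed
    then show ?thesis
      by (meson in_prime_factors_imp_prime prime_elem_imp_irreducible prime_imp_prime_elem)
  qed
  then obtain f where f: "irreducible f" "?c f = 0" by blast
  then have f0: "f \<noteq> 0" by auto
  define g where "g = (if lead_coeff f > 0 then f else - f)"
  have g: "irreducible g" "lead_coeff g > 0" "?c g = 0"
    using f f0 irreducible_mult_unit_left[of "-1" f] unfolding g_def
    by (auto simp: hom_distribs)
  show ?thesis
  proof (intro ex1I[of _ g] conjI g)
    fix h assume h: "irreducible h \<and> lead_coeff h > 0 \<and> ?c h = 0"
    then have "g dvd h" "h dvd g" using uniq g by auto
    then have "normalize h = normalize g" by (simp add: associated_iff_dvd)
    then show "h = g" using h g(2) by (simp add: normalize_poly_def)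
  qed
qed

text \<open>
  The logarithmic Mahler measure of a nonzero algebraic number. The lemma
  \<open>log_mahler_conv_mahler_measure\<close> relates the formula to the Mahler measure of integer
  polynomials in \<^theory>\<open>Berlekamp_Zassenhaus.Mahler_Measure\<close>.
\<close>

definition log_mahler :: "complex \<Rightarrow> real" where
  "log_mahler \<alpha> =
     (let f = min_int_poly \<alpha> in
        ln \<bar>real_of_int (lead_coeff f)\<bar>
        + (\<Sum>z\<in>#proots (map_poly of_int f :: complex poly). ln (max 1 (cmod z))))"

lemma proots_prod_list_linear: "proots (\<Prod>a\<leftarrow>xs. [:- a, 1:]) = mset (xs :: complex list)"
proof (induction xs)
  case (Cons a xs)
  have "proots ([:- a, 1:] * (\<Prod>a\<leftarrow>xs. [:- a, 1:])) = proots [:- a, 1:] + proots (\<Prod>a\<leftarrow>xs. [:- a, 1:])"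
    by (rule proots_mult) (auto simp: prod_list_zero_iff)
  then show ?case
    by (simp only: list.map prod_list.Cons Cons.IH proots_linear_factor) simp
qed simp

lemma log_mahler_conv_mahler_measure:
  fixes f :: "int poly"
  assumes "f \<noteq> 0"
  shows "ln (mahler_measure f) = ln \<bar>real_of_int (lead_coeff f)\<bar>
        + (\<Sum>z\<in>#proots (map_poly of_int f :: complex poly). ln (max 1 (cmod z)))"
proof -
  let ?f = "of_int_poly f :: complex poly"
  have f: "?f \<noteq> 0" using assms by simp
  have pr: "proots ?f = mset (complex_roots_complex ?f)"
  proof -
    let ?as = "complex_roots_complex ?f"
    have "proots ?f = proots (Polynomial.smult (lead_coeff ?f) (\<Prod>a\<leftarrow>?as. [:- a, 1:]))"
      by (simp only: complex_roots(1))
    also have "\<dots> = proots (\<Prod>a\<leftarrow>?as. [:- a, 1:])" using f by (intro proots_smult) simp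
    also have "\<dots> = mset ?as" by (rule proots_prod_list_linear)
    finally show ?thesis by blast
  qed
  have *: "(\<Prod>a\<leftarrow>xs. max 1 (cmod a)) > 0 \<and>
     ln (\<Prod>a\<leftarrow>xs. max 1 (cmod a)) = (\<Sum>z\<in>#mset xs. ln (max 1 (cmod z)))" for xs
    by (induction xs) (auto simp: ln_mult)
  show ?thesis
    unfolding mahler_measure_def mahler_measure_poly_def pr
    using assms *[of "complex_roots_complex ?f"] by (subst ln_mult) auto
qed

lemma log_mahler_rat:
  fixes r s :: int
  assumes "gcd r s = 1" "r \<noteq> 0" "s \<noteq> 0"
  shows "log_mahler (of_int r / of_int s) = ln (real_of_int (max \<bar>r\<bar> \<bar>s\<bar>))"
proof -
  define f where "f = [:- r * sgn s, \<bar>s\<bar>:]"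
  have "gcd (- r * sgn s) \<bar>s\<bar> = 1" using assms by (auto simp: sgn_if)
  then have f: "irreducible f" unfolding f_def by (intro irreducible_linear_poly) (use assms in \<open>auto simp: coprime_iff_gcd_eq_1\<close>)
  have root: "poly (of_int_poly f) (of_int r / of_int s :: complex) = 0"
    using assms by (auto simp: f_def sgn_if abs_if)
  have lc: "lead_coeff f > 0" using assms by (simp add: f_def)
  have "algebraic (of_int r / of_int s :: complex)"
    by (rule algebraicI[of "of_int_poly f"]) (use root f in auto)
  from min_int_poly_ex1[OF this] have m: "min_int_poly (of_int r / of_int s) = f"
    unfolding min_int_poly_def using f lc root by (intro the1_equality) auto
  have "proots (of_int_poly f :: complex poly) = {#of_int r / of_int s#}"
  proof -
    have "of_int_poly f = Polynomial.smult (of_int \<bar>s\<bar> :: complex) [:- (of_int r / of_int s), 1:]"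
      using assms by (auto simp: f_def sgn_if abs_if)
    then have "proots (of_int_poly f :: complex poly) = proots [:- (of_int r / of_int s :: complex), 1:]"
      by (simp only:) (rule proots_smult, use assms in simp)
    then show ?thesis by (simp only: proots_linear_factor) simp
  qed
  then have "log_mahler (of_int r / of_int s) =
      ln (real_of_int \<bar>s\<bar>) + ln (max 1 (real_of_int \<bar>r\<bar> / real_of_int \<bar>s\<bar>))"
    using assms unfolding log_mahler_def m Let_def by (simp add: f_def norm_divide)
  also have "\<dots> = ln (real_of_int \<bar>s\<bar> * max 1 (real_of_int \<bar>r\<bar> / real_of_int \<bar>s\<bar>))"
    by (subst ln_mult) (use assms in \<open>auto simp: less_max_iff_disj\<close>)
  also have "real_of_int \<bar>s\<bar> * max 1 (real_of_int \<bar>r\<bar> / real_of_int \<bar>s\<bar>) = real_of_int (max \<bar>r\<bar> \<bar>s\<bar>)"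
    using assms by (simp add: max_mult_distrib_left max.commute of_int_max)
  finally show ?thesis .
qed

definition fib_quot :: "nat \<Rightarrow> nat \<Rightarrow> nat \<Rightarrow> complex" where
  "fib_quot p q n = of_nat p ^ fib n / of_nat q ^ fib (n - 1)"

lemma log_mahler_fib_quot:
  assumes "prime p" "prime q" "p \<noteq> q"
  shows "log_mahler (fib_quot p q n) = max (fib n * ln (real p)) (fib (n - 1) * ln (real q))"
proof -
  have pq: "p > 0" "q > 0" using assms by (auto simp: prime_gt_0_nat)
  have "gcd (p ^ fib n) (q ^ fib (n - 1)) = 1"
    using primes_coprime[OF assms] by (intro coprime_imp_gcd_eq_1) simp
  then have c: "gcd (int (p ^ fib n)) (int (q ^ fib (n - 1))) = 1"
    by (simp only: gcd_int_int_eq of_nat_1)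
  have "fib_quot p q n = of_int (int (p ^ fib n)) / of_int (int (q ^ fib (n - 1)))"
    by (simp add: fib_quot_def)
  then have "log_mahler (fib_quot p q n) =
      ln (real_of_int (max \<bar>int (p ^ fib n)\<bar> \<bar>int (q ^ fib (n - 1))\<bar>))"
    using log_mahler_rat[OF c] pq by simp
  also have "\<dots> = ln (max (real p ^ fib n) (real q ^ fib (n - 1)))"
    by (simp add: of_int_max)
  also have "\<dots> = max (ln (real p ^ fib n)) (ln (real q ^ fib (n - 1)))"
    using pq by (simp add: max_def)
  finally show ?thesis using pq by (simp add: ln_realpow)
qed

lemma powr_sum_ex1:
  fixes a b c :: real
  assumes "0 < b" "0 < c" "b < a" "c < a"
  shows "\<exists>!t. t > 0 \<and> a powr t = b powr t + c powr t"
proof -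
  define g where "g = (\<lambda>t. (b / a) powr t + (c / a) powr t)"
  have a: "a > 0" using assms by linarith
  have eq: "a powr t = b powr t + c powr t \<longleftrightarrow> g t = 1" for t
    using a assms by (simp add: g_def powr_divide field_simps)
  have r: "0 < b / a" "b / a < 1" "0 < c / a" "c / a < 1" using a assms by auto
  have mono: "g t < g s" if "s < t" for s t
    unfolding g_def using r that by (intro add_strict_mono powr_less_mono') auto
  have "((\<lambda>t. x powr t) \<longlongrightarrow> 0) at_top" if "0 < x" "x < 1" for x :: real
  proof -
    have "ln x < 0" using that by simp
    then have "((\<lambda>t. exp (t * ln x)) \<longlongrightarrow> 0) at_top" by real_asymp
    then show ?thesis using that by (simp add: powr_def)
  qed
  from this[OF r(1,2)] this[OF r(3,4)]
  have "(g \<longlongrightarrow> 0 + 0) at_top" unfolding g_def by (intro tendsto_add)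
  then have "eventually (\<lambda>t. g t < 1) at_top" by (auto simp: order_tendsto_iff)
  then obtain T where T: "g T < 1" "T > 0"
    by (metis (no_types, lifting) eventually_at_top_linorder eventually_gt_at_top eventually_conj order_refl)
  have "g 0 = 2" using assms a by (simp add: g_def)
  moreover have "continuous_on {0..T} g"
    unfolding g_def using r by (intro continuous_intros) auto
  ultimately obtain t where t: "0 \<le> t" "t \<le> T" "g t = 1"
    using IVT2'[of g T 1 0] T by auto
  then have "t > 0" using \<open>g 0 = 2\<close> by (cases "t = 0") auto
  show ?thesis
    unfolding eq using t \<open>t > 0\<close> mono by (metis less_irrefl linorder_neqE_linordered_idom)
qed

definition cond_W :: "nat \<Rightarrow> nat \<Rightarrow> nat \<Rightarrow> bool" where
  "cond_W N p q \<longleftrightarrow>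
     (real (fib N) / real (fib (N - 1)) < ln (real q) / ln (real p) \<and>
      ln (real q) / ln (real p) < real (fib (N - 1)) / real (fib (N - 2)))
   \<or> (real (fib (N - 1)) / real (fib (N - 2)) < ln (real q) / ln (real p) \<and>
      ln (real q) / ln (real p) < real (fib N) / real (fib (N - 1)))"

text \<open>
  Under \<^const>\<open>cond_W\<close> (for some \<open>N \<ge> 3\<close>) and for \<open>n \<ge> 3\<close>, the definite description
  denotes; see \<open>t_exp_ex1\<close> below.
\<close>

definition t_exp :: "nat \<Rightarrow> nat \<Rightarrow> nat \<Rightarrow> real" where
  "t_exp p q n =
     (THE t. t > 0 \<and>
        log_mahler (fib_quot p q n) powr t =
          log_mahler (fib_quot p q (n - 1)) powr t + log_mahler (fib_quot p q (n - 2)) powr t)"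

lemma cond_W_bounds:
  assumes "N \<ge> 3" "cond_W N p q"
  shows "1 < ln (real q) / ln (real p)" "ln (real q) / ln (real p) < 2"
proof -
  have *: "1 \<le> real (fib (Suc m)) / real (fib m) \<and> real (fib (Suc m)) / real (fib m) \<le> 2"
    if "m > 0" for m
  proof -
    define k where "k = m - 1"
    have "m = Suc k" using that by (simp add: k_def)
    then show ?thesis using fib_neq_0_nat[OF that] fib_Suc_mono[of k]
      by (auto simp: field_simps)
  qed
  obtain k where k: "N = Suc (Suc k)" "k > 0"
    using assms(1) by (intro that[of "N - 2"]) auto
  show "1 < ln (real q) / ln (real p)" "ln (real q) / ln (real p) < 2"
    using assms(2) *[of k] *[of "Suc k"] k unfolding cond_W_def by auto
qed

lemma t_exp_ex1:
  assumes "prime p" "prime q" "N \<ge> 3" "cond_W N p q" "n \<ge> 3"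
  shows "\<exists>!t. t > 0 \<and>
        log_mahler (fib_quot p q n) powr t =
          log_mahler (fib_quot p q (n - 1)) powr t + log_mahler (fib_quot p q (n - 2)) powr t"
proof -
  note x = cond_W_bounds[OF assms(3,4)]
  have p: "ln (real p) > 0" "ln (real q) > 0"
    using prime_gt_1_nat[OF assms(1)] prime_gt_1_nat[OF assms(2)] by auto
  have x: "ln (real p) < ln (real q)" "ln (real q) < 2 * ln (real p)"
    using x p by (auto simp: field_simps)
  then have "p \<noteq> q" by auto
  note m = log_mahler_fib_quot[OF assms(1,2) this]
  obtain k where k: "n = Suc (Suc (Suc k))"
    using assms(5) by (intro that[of "n - 3"]) auto
  have pos: "real (fib (Suc k)) > 0" using fib_neq_0_nat[of "Suc k"] by simp
  define P Q where "P = ln (real p)" and "Q = ln (real q)"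
  define u v where "u = real (fib k)" and "v = real (fib (Suc k))"
  have uv: "u \<ge> 0" "v > 0" "u \<le> v" using pos fib_Suc_mono[of k] by (auto simp: u_def v_def)
  have PQ: "0 < P" "P < Q" "Q < 2 * P" using p x by (auto simp: P_def Q_def)
  have m1: "log_mahler (fib_quot p q n) = max ((u + 2 * v) * P) ((u + v) * Q)"
    "log_mahler (fib_quot p q (n - 1)) = max ((u + v) * P) (v * Q)"
    "log_mahler (fib_quot p q (n - 2)) = max (v * P) (u * Q)"
    by (simp_all add: m k u_def v_def P_def Q_def algebra_simps)
  have pv: "0 < v * P" "v * P < v * Q" "v * Q < v * (2 * P)" "u * P \<le> u * Q" "0 \<le> u * P"
    "u * Q \<le> u * (2 * P)" "u * Q \<le> v * Q"
    using uv PQ by (auto intro!: mult_left_mono mult_right_mono)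
  show ?thesis unfolding m1
    by (rule powr_sum_ex1) (use pv in \<open>auto simp: algebra_simps max_def\<close>)
qed

definition compatible :: "nat \<Rightarrow> nat \<Rightarrow> nat \<Rightarrow> bool" where
  "compatible N p q \<longleftrightarrow>
     prime p \<and> prime q \<and> cond_W N p q \<and> (\<forall>n\<in>{3..N}. t_exp p q (n + 1) < t_exp p q n)"

end

theory Submission
  imports Defs "HOL-Analysis.Convex"
begin

text \<open>
  With \<open>x = log q / log p\<close>, dividing by \<open>log p\<close> turns the \<open>n\<close>-th Mahler measure into
  \<open>max h\<^sub>n (h\<^bsub>n-1\<^esub> x)\<close>, and \<open>t\<^sub>n\<close> is the root of a decreasing function \<open>G\<^sub>n(x, \<cdot>)\<close>.
  At the golden ratio \<open>\<phi>\<close> one has \<open>G\<^bsub>n+1\<^esub> < G\<^sub>n\<close> on \<open>[1,2]\<close>, with both functions above 1 at 1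
  and below 1 at 2. Hence their mean takes the value 1 at some \<open>\<tau>\<close>, where
  \<open>G\<^bsub>n+1\<^esub>(\<phi>, \<tau>) < 1 < G\<^sub>n(\<phi>, \<tau>)\<close>. For fixed \<open>\<tau>\<close> these two strict inequalities persist for \<open>x\<close>
  near \<open>\<phi>\<close>, and there they force \<open>t\<^bsub>n+1\<^esub> < \<tau> < t\<^sub>n\<close>.
\<close>

section \<open>The golden ratio and Fibonacci numbers\<close>

definition golden :: real where
  "golden = (1 + sqrt 5) / 2"

lemma golden_gt: "golden > 8/5" and golden_lt: "golden < 5/3"
proof -
  have "sqrt 5 > 11/5" by (rule real_less_rsqrt) (simp add: power2_eq_square)
  moreover have "sqrt 5 < 7/3" by (rule real_less_lsqrt) (simp_all add: power2_eq_square)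
  ultimately show "golden > 8/5" "golden < 5/3" by (auto simp: golden_def)
qed

lemma golden_pos [simp]: "golden > 0"
  using golden_gt by linarith

lemma golden_neq_0 [simp]: "golden \<noteq> 0"
  using golden_pos by (rule less_imp_neq [symmetric])

lemma golden_mult_golden: "golden * golden = golden + 1"
  by (simp add: golden_def field_simps)

text \<open>Since \<open>1 - golden\<close> is the other root of \<open>z\<^sup>2 = z + 1\<close>,
  the error term satisfies the Fibonacci recurrence. It alternates in sign, which decides the parity
  cases below.\<close>

lemma fib_Suc_golden: "real (fib (Suc n)) = golden * real (fib n) + (1 - golden) ^ n"
proof (induction n)
  case (Suc n)
  have "golden * real (fib (Suc n)) = (golden * golden) * real (fib n) + golden * (1 - golden) ^ n"
    by (simp only: Suc distrib_left mult.assoc)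
  also have "\<dots> = real (fib (Suc n)) + real (fib n) - (1 - golden) * (1 - golden) ^ n"
    by (simp only: Suc golden_mult_golden) (simp add: algebra_simps)
  finally show ?case by simp
qed simp

lemma fib_Suc_even_gt: "real (fib (Suc (2 * k))) > golden * real (fib (2 * k))"
  using golden_gt by (simp add: fib_Suc_golden [of "2 * k"] power_mult)

lemma fib_Suc_odd_lt: "real (fib (Suc (Suc (2 * k)))) < golden * real (fib (Suc (2 * k)))"
  using golden_gt
  by (simp add: fib_Suc_golden [of "Suc (2 * k)"] power_mult mult_less_0_iff del: fib.simps)

section \<open>Mahler measures divided by \<open>ln p\<close>\<close>

text \<open>By \<open>log_mahler_fib_quot\<close>, \<open>ln p * fib_max n (ln q / ln p)\<close> is the \<open>n\<close>-th Mahler measure.\<close>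

definition fib_max :: "nat \<Rightarrow> real \<Rightarrow> real" where
  "fib_max n x = max (real (fib n)) (real (fib (n - 1)) * x)"

text \<open>The right side of the equation for \<open>t_exp p q n\<close> over its left side, so
  that the exponent solves \<open>G n x t = 1\<close>.\<close>

definition G :: "nat \<Rightarrow> real \<Rightarrow> real \<Rightarrow> real" where
  "G n x t = (fib_max (n - 1) x / fib_max n x) powr t + (fib_max (n - 2) x / fib_max n x) powr t"

lemma fib_max_pos: "n > 0 \<Longrightarrow> fib_max n x > 0"
  using fib_neq_0_nat [of n] by (simp add: fib_max_def less_max_iff_disj)

lemma fib_max_Suc_mono: "x \<ge> 0 \<Longrightarrow> fib_max n x \<le> fib_max (Suc n) x"
  using fib_Suc_mono [of n] fib_Suc_mono [of "n - 1"] unfolding fib_max_def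
  by (intro max.mono mult_right_mono) (cases n; simp)+

lemma tendsto_fib_max [tendsto_intros]: "(fib_max n \<longlongrightarrow> fib_max n x) (nhds x)"
  unfolding fib_max_def by (intro tendsto_intros filterlim_ident)

lemma tendsto_G:
  assumes "n \<ge> 3"
  shows "((\<lambda>x. G n x t) \<longlongrightarrow> G n x t) (nhds x)"
proof -
  have "fib_max n x > 0" "fib_max (n - 1) x > 0" "fib_max (n - 2) x > 0" using assms by (auto intro!: fib_max_pos)
  then show ?thesis unfolding G_def by (intro tendsto_intros) auto
qed

lemma continuous_on_G:
  assumes "n \<ge> 3"
  shows "continuous_on A (G n x)"
proof -
  have "fib_max n x > 0" "fib_max (n - 1) x > 0" "fib_max (n - 2) x > 0" using assms by (auto intro!: fib_max_pos)
  then show ?thesis unfolding G_def by (intro continuous_intros) auto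
qed

text \<open>Both bases are at most 1, as \<open>fib_max\<close> is nondecreasing in its index. The
  weak form suffices to order arguments whose values differ strictly.\<close>

lemma G_antimono:
  assumes "n \<ge> 3" "x \<ge> 0" "s \<le> t"
  shows "G n x t \<le> G n x s"
proof -
  obtain k where k: "n = Suc (Suc (Suc k))" using assms(1) by (intro that [of "n - 3"]) auto
  have "fib_max (Suc k) x > 0" "fib_max (Suc (Suc k)) x > 0" "fib_max n x > 0" by (auto simp: k intro!: fib_max_pos)
  moreover have "fib_max (Suc k) x \<le> fib_max (Suc (Suc k)) x" "fib_max (Suc (Suc k)) x \<le> fib_max n x"
    using fib_max_Suc_mono [OF assms(2)] by (auto simp: k)
  ultimately show ?thesis using assms(3)
    unfolding G_def by (intro add_mono powr_mono') (auto simp: k)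
qed

section \<open>Values at the golden ratio\<close>

lemma fib_max_golden_odd: "fib_max (Suc (2 * k)) golden = real (fib (Suc (2 * k)))"
  using fib_Suc_even_gt [of k] by (simp add: fib_max_def max_def mult.commute)

lemma fib_max_golden_even: "fib_max (Suc (Suc (2 * k))) golden = golden * real (fib (Suc (2 * k)))"
  using fib_Suc_odd_lt [of k] by (simp add: fib_max_def max_def mult.commute)

text \<open>With \<open>a = fib (2 * k + 1)\<close> and \<open>b = fib (2 * k + 3)\<close>, the
  values of \<open>fib_max\<close> at \<open>golden\<close> for the indices \<open>2 * k + 1\<close>
  to \<open>2 * k + 4\<close> are \<open>a\<close>, \<open>golden * a\<close>, \<open>b\<close>,
  \<open>golden * b\<close>. Hence \<open>G\<close> at \<open>2 * k + 3\<close> and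
  \<open>2 * k + 4\<close> depends on \<open>k\<close> only through \<open>a / b\<close>.\<close>

definition odd_fib_ratio :: "nat \<Rightarrow> real" where
  "odd_fib_ratio k = real (fib (2 * k + 1)) / real (fib (2 * k + 3))"

lemma G_golden_odd: "G (2 * k + 3) golden t = (odd_fib_ratio k * golden) powr t + odd_fib_ratio k powr t"
  using fib_max_golden_odd [of k] fib_max_golden_even [of k] fib_max_golden_odd [of "Suc k"]
  by (simp add: G_def odd_fib_ratio_def numeral_3_eq_3 mult.commute)

lemma G_golden_even: "G (2 * k + 4) golden t = (1 / golden) powr t + odd_fib_ratio k powr t"
proof -
  have "2 * k + 4 = Suc (Suc (2 * Suc k))" "2 * k + 3 = Suc (2 * Suc k)"
    "2 * k + 4 - 1 = Suc (2 * Suc k)" "2 * k + 4 - 2 = Suc (Suc (2 * k))" "2 * k + 1 = Suc (2 * k)"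
    by simp_all
  moreover have "fib (Suc (2 * Suc k)) > 0" by (rule fib_neq_0_nat) simp
  ultimately show ?thesis
    unfolding G_def odd_fib_ratio_def
    by (simp only: fib_max_golden_even fib_max_golden_odd) (simp del: fib.simps)
qed

text \<open>The relative excess of \<open>odd_fib_ratio k\<close> over its limit
  \<open>1 / golden\<^sup>2\<close>, obtained from \<open>fib_Suc_golden\<close> at the odd index
  \<open>2 * k + 1\<close>.\<close>

lemma odd_fib_ratio_golden: "odd_fib_ratio k * golden\<^sup>2 - 1 = (golden - 1) ^ (2 * k + 1) / real (fib (2 * k + 3))"
proof -
  have pos: "real (fib (2 * k + 3)) > 0" using fib_neq_0_nat [of "2 * k + 3"] by simp
  have f: "real (fib (2 * k + 3)) = real (fib (2 * k + 2)) + real (fib (2 * k + 1))"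
    by (simp add: numeral_3_eq_3)
  have "(1 - golden) ^ (2 * k + 1) = - ((golden - 1) ^ (2 * k + 1))"
    by (metis minus_diff_eq power_minus_odd even_mult_iff even_numeral odd_one odd_add)
  then have "(golden - 1) ^ (2 * k + 1) = golden * real (fib (2 * k + 1)) - real (fib (2 * k + 2))"
    using fib_Suc_golden [of "2 * k + 1"] by simp
  also have "\<dots> = golden\<^sup>2 * real (fib (2 * k + 1)) - real (fib (2 * k + 3))"
    by (simp only: f power2_eq_square golden_mult_golden) (simp add: algebra_simps)
  finally show ?thesis using pos by (simp add: odd_fib_ratio_def field_simps)
qed

lemma fib_ge_double: "2 * fib n \<le> fib (n + 2)"
  using fib_Suc_mono [of n] by simp

lemma odd_fib_ratio_pos: "odd_fib_ratio k > 0" and odd_fib_ratio_le: "odd_fib_ratio k \<le> 1 / 2" and odd_fib_ratio_gt: "odd_fib_ratio k * golden\<^sup>2 > 1"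
proof -
  have pos: "real (fib (2 * k + 3)) > 0" "real (fib (2 * k + 1)) > 0"
    using fib_neq_0_nat [of "2 * k + 3"] fib_neq_0_nat [of "2 * k + 1"] by simp_all
  then show "odd_fib_ratio k > 0" by (simp add: odd_fib_ratio_def)
  have "2 * real (fib (2 * k + 1)) \<le> real (fib (2 * k + 3))"
    using fib_ge_double [of "2 * k + 1"] by (simp add: numeral_3_eq_3)
  then show "odd_fib_ratio k \<le> 1 / 2" using pos by (simp add: odd_fib_ratio_def field_simps)
  have "(golden - 1) ^ (2 * k + 1) / real (fib (2 * k + 3)) > 0"
    using pos golden_gt by (intro divide_pos_pos zero_less_power) auto
  then show "odd_fib_ratio k * golden\<^sup>2 > 1" using odd_fib_ratio_golden [of k] by simp
qed

text \<open>From \<open>k\<close> to \<open>Suc k\<close> the numerator in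
  \<open>odd_fib_ratio_golden\<close> gains the factor
  \<open>(golden - 1)\<^sup>2 = 1 / golden\<^sup>2\<close>, while the denominator at least
  doubles.\<close>

lemma odd_fib_ratio_Suc_excess: "2 * golden\<^sup>2 * (odd_fib_ratio (Suc k) * golden\<^sup>2 - 1) \<le> odd_fib_ratio k * golden\<^sup>2 - 1"
proof -
  define c where "c = (golden - 1) ^ (2 * k + 1)"
  have c: "c > 0" using golden_gt by (simp add: c_def)
  have pos: "real (fib (2 * k + 3)) > 0" "real (fib (2 * k + 5)) > 0"
    using fib_neq_0_nat [of "2 * k + 3"] fib_neq_0_nat [of "2 * k + 5"] by simp_all
  have le: "2 * real (fib (2 * k + 3)) \<le> real (fib (2 * k + 5))"
    using fib_ge_double [of "2 * k + 3"] by (simp add: eval_nat_numeral)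
  have "golden * (golden - 1) = 1" by (simp add: golden_mult_golden algebra_simps)
  then have g: "golden\<^sup>2 * (golden - 1)\<^sup>2 = 1" by (metis power_mult_distrib power_one)
  have "(golden - 1) ^ (2 * Suc k + 1) = (golden - 1)\<^sup>2 * c"
    by (simp add: c_def power2_eq_square)
  then have "2 * golden\<^sup>2 * (odd_fib_ratio (Suc k) * golden\<^sup>2 - 1) = 2 * (golden\<^sup>2 * (golden - 1)\<^sup>2) * c / real (fib (2 * k + 5))"
    using odd_fib_ratio_golden [of "Suc k"] by (simp add: eval_nat_numeral)
  also have "\<dots> = 2 * c / real (fib (2 * k + 5))" by (simp add: g)
  also have "\<dots> \<le> c / real (fib (2 * k + 3))"
    using le c pos mult_left_mono [OF le, of c] by (simp add: field_simps)
  also have "\<dots> = odd_fib_ratio k * golden\<^sup>2 - 1" by (simp add: odd_fib_ratio_golden c_def)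
  finally show ?thesis .
qed

section \<open>Comparison of consecutive indices at the golden ratio\<close>

text \<open>Convexity of the power function: \<open>1 + u\<close> is the mean of 1 and
  \<open>1 + c * u\<close> with weights \<open>1 - 1 / c\<close> and \<open>1 / c\<close>.\<close>

lemma powr_excess_superlinear:
  fixes u c t :: real
  assumes "u \<ge> 0" "c \<ge> 1" "t \<ge> 1"
  shows "c * ((1 + u) powr t - 1) \<le> (1 + c * u) powr t - 1"
proof -
  have "((1 - 1 / c) *\<^sub>R 1 + (1 / c) *\<^sub>R (1 + c * u)) powr t
      \<le> (1 - 1 / c) * 1 powr t + (1 / c) * (1 + c * u) powr t"
    by (rule convex_onD [OF powr_convex]) (use assms in \<open>auto intro: add_pos_nonneg\<close>)
  moreover have "(1 - 1 / c) *\<^sub>R 1 + (1 / c) *\<^sub>R (1 + c * u) = 1 + u"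
    using assms by (simp add: left_diff_distrib distrib_left)
  ultimately have "(1 + u) powr t \<le> 1 - 1 / c + (1 + c * u) powr t / c"
    by (simp only:) simp
  then have "c * (1 + u) powr t \<le> c * (1 - 1 / c + (1 + c * u) powr t / c)"
    using assms by (intro mult_left_mono) auto
  also have "\<dots> = c - 1 + (1 + c * u) powr t" using assms by (simp add: field_simps)
  finally show ?thesis by (simp add: right_diff_distrib)
qed

text \<open>The summand \<open>odd_fib_ratio k powr t\<close> is common to both sides; the others
  compare by \<open>odd_fib_ratio_gt\<close>.\<close>

lemma G_golden_even_less:
  assumes "t > 0"
  shows "G (2 * k + 4) golden t < G (2 * k + 3) golden t"
proof -
  have "1 / golden < odd_fib_ratio k * golden"
    using odd_fib_ratio_gt [of k] by (simp add: field_simps power2_eq_square)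
  then have "(1 / golden) powr t < (odd_fib_ratio k * golden) powr t"
    using assms by (intro powr_less_mono2) (auto simp: less_imp_le)
  then show ?thesis by (simp add: G_golden_odd G_golden_even)
qed

text \<open>From \<open>2 * k + 4\<close> to \<open>2 * k + 5\<close> the first summand grows and
  the second shrinks. The second effect wins because the excess of \<open>odd_fib_ratio\<close>
  falls so fast; \<open>t \<ge> 1\<close> serves convexity, \<open>t \<le> 2\<close> bounds
  \<open>golden powr t\<close>.\<close>

lemma G_golden_odd_less:
  assumes "1 \<le> t" "t \<le> 2"
  shows "G (2 * k + 5) golden t < G (2 * k + 4) golden t"
proof -
  (* Times golden powr (2 * t), the claim is (f + 1) * (s' powr t - 1) < s powr t - 1. *)
  define s s' f where "s = odd_fib_ratio k * golden\<^sup>2" and "s' = odd_fib_ratio (Suc k) * golden\<^sup>2" and "f = golden powr t"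
  have s': "s' > 1" using odd_fib_ratio_gt [of "Suc k"] by (simp add: s'_def)
  have f: "f > 0" "f \<le> golden\<^sup>2"
    using assms golden_gt powr_mono [of t 2 golden] by (auto simp: f_def)
  have g: "golden\<^sup>2 > 1" using golden_gt by simp
  have "s' powr t > 1" using s' assms powr_less_mono2 [of t 1 s'] by simp
  \<comment> \<open>\<open>f + 1 \<le> golden\<^sup>2 + 1 < 2 * golden\<^sup>2\<close>, the factor
    in \<open>odd_fib_ratio_Suc_excess\<close>.\<close>
  then have "(f + 1) * (s' powr t - 1) < 2 * golden\<^sup>2 * (s' powr t - 1)"
    using f g by (intro mult_strict_right_mono) auto
  also have "\<dots> = 2 * golden\<^sup>2 * ((1 + (s' - 1)) powr t - 1)" by simp
  also have "\<dots> \<le> (1 + 2 * golden\<^sup>2 * (s' - 1)) powr t - 1"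
    by (rule powr_excess_superlinear) (use s' g assms in auto)
  also have "\<dots> \<le> s powr t - 1"
    using odd_fib_ratio_Suc_excess [of k] s' assms
    by (intro diff_right_mono powr_mono2) (auto simp: s_def s'_def intro!: add_nonneg_nonneg)
  finally have less: "s' powr t * f + s' powr t < f + s powr t"
    by (simp add: algebra_simps)
  have sc: "odd_fib_ratio j powr t = (odd_fib_ratio j * golden\<^sup>2) powr t / (f * f)" for j
    using odd_fib_ratio_pos [of j] by (simp add: f_def powr_mult power2_eq_square)
  have "G (2 * k + 5) golden t = (odd_fib_ratio (Suc k) * golden) powr t + odd_fib_ratio (Suc k) powr t"
    using G_golden_odd [of "Suc k"] by (simp add: eval_nat_numeral)
  also have "\<dots> = odd_fib_ratio (Suc k) powr t * f + odd_fib_ratio (Suc k) powr t"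
    using odd_fib_ratio_pos [of "Suc k"] by (simp add: f_def powr_mult)
  also have "\<dots> = (s' powr t * f + s' powr t) / (f * f)"
    by (simp add: sc [of "Suc k"] s'_def add_divide_distrib)
  also have "\<dots> < (f + s powr t) / (f * f)"
    using less f by (intro divide_strict_right_mono) auto
  also have "\<dots> = 1 / f + odd_fib_ratio k powr t"
    using f by (simp add: sc [of k] s_def add_divide_distrib)
  also have "\<dots> = G (2 * k + 4) golden t"
    by (simp add: G_golden_even f_def powr_divide)
  finally show ?thesis .
qed

lemma index_cases:
  assumes "n \<ge> (3::nat)"
  obtains k where "n = 2 * k + 3" | k where "n = 2 * k + 4"
proof (cases "odd n")
  case True
  then obtain j where "n = 2 * j + 1" by (elim oddE)
  then have "n = 2 * (j - 1) + 3" using assms by simp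
  then show thesis by (rule that)
next
  case False
  then obtain j where "n = 2 * j" by (auto elim: evenE)
  then have "n = 2 * (j - 2) + 4" using assms by simp
  then show thesis by (rule that)
qed

lemma G_golden_Suc_less:
  assumes "n \<ge> 3" "1 \<le> t" "t \<le> 2"
  shows "G (Suc n) golden t < G n golden t"
  using assms(1)
proof (cases rule: index_cases)
  case (1 k)
  then show ?thesis using G_golden_even_less [of t k] assms by (simp add: eval_nat_numeral)
next
  case (2 k)
  then show ?thesis using G_golden_odd_less [of t k] assms by (simp add: eval_nat_numeral)
qed

section \<open>Bounds at \<open>t = 1\<close> and \<open>t = 2\<close>, and separation\<close>

text \<open>For even \<open>n\<close>, replacing \<open>odd_fib_ratio k\<close> by its strict lower
  bound \<open>1 / golden\<^sup>2\<close> gives exactly 1; for odd \<open>n\<close> the sum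
  factors.\<close>

lemma G_golden_1:
  assumes "n \<ge> 3"
  shows "G n golden 1 > 1"
  using assms
proof (cases rule: index_cases)
  case (1 k)
  have "G n golden 1 = odd_fib_ratio k * (golden * golden)"
    using odd_fib_ratio_pos [of k] unfolding 1 G_golden_odd
    by (simp add: golden_mult_golden less_imp_le algebra_simps)
  then show ?thesis using odd_fib_ratio_gt [of k] by (simp add: power2_eq_square)
next
  case (2 k)
  have "1 / golden\<^sup>2 < odd_fib_ratio k" using odd_fib_ratio_gt [of k] by (simp add: field_simps)
  moreover have "1 / golden + 1 / golden\<^sup>2 = (golden + 1) / (golden * golden)"
    by (simp add: add_divide_distrib power2_eq_square)
  moreover have "\<dots> = 1" by (simp flip: golden_mult_golden)
  ultimately show ?thesis using odd_fib_ratio_pos [of k] by (simp add: 2 G_golden_even less_imp_le)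
qed

text \<open>For odd \<open>n\<close>, \<open>odd_fib_ratio k \<le> 1 / 2\<close> bounds the sum of
  squares by \<open>(golden + 2) / 4\<close>. Even \<open>n\<close> follows from
  \<open>G_golden_even_less\<close>.\<close>

lemma G_golden_2:
  assumes "n \<ge> 3"
  shows "G n golden 2 < 1"
proof -
  have odd: "G (2 * k + 3) golden 2 < 1" for k
  proof -
    have "G (2 * k + 3) golden 2 = (odd_fib_ratio k)\<^sup>2 * (golden + 2)"
    proof -
      have "(odd_fib_ratio k * golden) powr 2 = (odd_fib_ratio k)\<^sup>2 * (golden * golden)" "odd_fib_ratio k powr 2 = (odd_fib_ratio k)\<^sup>2"
        using odd_fib_ratio_pos [of k] by (simp_all add: powr_mult less_imp_le power2_eq_square)
      then show ?thesis unfolding G_golden_odd by (simp add: golden_mult_golden algebra_simps)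
    qed
    also have "\<dots> \<le> (1 / 2)\<^sup>2 * (golden + 2)"
      using odd_fib_ratio_le [of k] odd_fib_ratio_pos [of k] by (intro mult_right_mono power_mono) (auto simp: less_imp_le add_nonneg_nonneg)
    also have "\<dots> < 1" using golden_lt by (simp add: power2_eq_square)
    finally show ?thesis .
  qed
  from assms show ?thesis
  proof (cases rule: index_cases)
    case (1 k)
    then show ?thesis using odd by simp
  next
    case (2 k)
    then show ?thesis using odd [of k] G_golden_even_less [of 2 k] by simp
  qed
qed

lemma G_golden_separate:
  assumes "n \<ge> 3"
  obtains \<tau> where "G (Suc n) golden \<tau> < 1" "G n golden \<tau> > 1"
proof -
  have n: "Suc n \<ge> 3" using assms by simp
  have "\<exists>\<tau>. 1 \<le> \<tau> \<and> \<tau> \<le> 2 \<and> G (Suc n) golden \<tau> + G n golden \<tau> = 2"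
    using G_golden_1 [OF assms] G_golden_1 [OF n] G_golden_2 [OF assms] G_golden_2 [OF n]
    by (intro IVT2' continuous_intros continuous_on_G assms n) auto
  then obtain \<tau> where "1 \<le> \<tau>" "\<tau> \<le> 2" "G (Suc n) golden \<tau> + G n golden \<tau> = 2" by blast
  with G_golden_Suc_less [OF assms, of \<tau>] show thesis by (intro that [of \<tau>]) auto
qed

section \<open>Condition (W) and the exponents near the golden ratio\<close>

lemma fib_ratio_odd_lt: "real (fib (2 * k + 2)) / real (fib (2 * k + 1)) < golden"
  using fib_Suc_odd_lt [of k] fib_neq_0_nat [of "2 * k + 1"] by (simp add: field_simps)

lemma fib_ratio_even_gt: "golden < real (fib (2 * k + 3)) / real (fib (2 * k + 2))"
  using fib_Suc_even_gt [of "Suc k"] fib_neq_0_nat [of "2 * k + 2"]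
  by (simp add: pos_less_divide_eq numeral_3_eq_3 del: fib.simps)

text \<open>Consecutive Fibonacci quotients lie strictly on opposite sides of \<open>golden\<close>;
  the parity of \<open>N\<close> selects the disjunct of \<open>cond_W\<close>.\<close>

lemma eventually_cond_W_golden:
  assumes "N \<ge> 3"
  shows "\<forall>\<^sub>F x in nhds golden. \<forall>p q. ln (real q) / ln (real p) = x \<longrightarrow> cond_W N p q"
  using assms
proof (cases rule: index_cases)
  case (1 k)
  have "\<forall>\<^sub>F x in nhds golden. x \<in> {real (fib (2 * k + 2)) / real (fib (2 * k + 1)) <..< real (fib (2 * k + 3)) / real (fib (2 * k + 2))}"
    using fib_ratio_odd_lt [of k] fib_ratio_even_gt [of k] by (intro eventually_nhds_in_open) auto
  then show ?thesis by eventually_elim (auto simp: cond_W_def 1 eval_nat_numeral)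
next
  case (2 k)
  have "\<forall>\<^sub>F x in nhds golden. x \<in> {real (fib (2 * k + 4)) / real (fib (2 * k + 3)) <..< real (fib (2 * k + 3)) / real (fib (2 * k + 2))}"
    using fib_ratio_odd_lt [of "Suc k"] fib_ratio_even_gt [of k]
    by (intro eventually_nhds_in_open) (auto simp: eval_nat_numeral)
  then show ?thesis by eventually_elim (auto simp: cond_W_def 2 eval_nat_numeral)
qed

lemma G_t_exp:
  assumes "prime p" "prime q" "N \<ge> 3" "cond_W N p q" "n \<ge> 3"
  shows "G n (ln (real q) / ln (real p)) (t_exp p q n) = 1"
proof -
  define x where "x = ln (real q) / ln (real p)"
  have P: "ln (real p) > 0" using prime_gt_1_nat [OF assms(1)] by simp
  have "x > 1" using cond_W_bounds [OF assms(3,4)] by (simp add: x_def)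
  \<comment> \<open>Equal primes would give \<open>x = 1\<close>.\<close>
  then have "p \<noteq> q" using P by (auto simp: x_def)
  have m: "log_mahler (fib_quot p q j) = ln (real p) * fib_max j x" for j
    using P by (simp add: log_mahler_fib_quot [OF assms(1,2) \<open>p \<noteq> q\<close>] fib_max_def x_def max_mult_distrib_left mult.commute)
  have pos: "fib_max n x > 0" "fib_max (n - 1) x > 0" "fib_max (n - 2) x > 0" using assms(5) by (auto intro!: fib_max_pos)
  define t where "t = t_exp p q n"
  have "log_mahler (fib_quot p q n) powr t =
      log_mahler (fib_quot p q (n - 1)) powr t + log_mahler (fib_quot p q (n - 2)) powr t"
    using theI' [OF t_exp_ex1 [OF assms]] unfolding t_def t_exp_def by blast
  then have "ln (real p) powr t * fib_max n x powr t = ln (real p) powr t * (fib_max (n - 1) x powr t + fib_max (n - 2) x powr t)"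
    using P pos by (simp add: m powr_mult distrib_left)
  then have "fib_max n x powr t = fib_max (n - 1) x powr t + fib_max (n - 2) x powr t" using P by simp
  moreover have "fib_max n x powr t \<noteq> 0" using pos by simp
  moreover have "G n x t = (fib_max (n - 1) x powr t + fib_max (n - 2) x powr t) / fib_max n x powr t"
    using pos by (simp add: G_def powr_divide add_divide_distrib)
  ultimately show ?thesis by (simp flip: t_def x_def)
qed

theorem theorem2p2:
  fixes N :: nat
  assumes "N \<ge> 3"
  shows "\<exists>\<delta>::real. \<delta> > 0 \<and>
           (\<forall>p q :: nat. prime p \<longrightarrow> prime q \<longrightarrow>
              \<bar>ln (real q) / ln (real p) - (1 + sqrt 5) / 2\<bar> < \<delta> \<longrightarrow> compatible N p q)"
proof -
  have "\<exists>\<tau>. G (Suc n) golden \<tau> < 1 \<and> G n golden \<tau> > 1" if "n \<in> {3..N}" for n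
    using that G_golden_separate [of n] by fastforce
  then obtain \<tau> where \<tau>: "G (Suc n) golden (\<tau> n) < 1 \<and> G n golden (\<tau> n) > 1" if "n \<in> {3..N}" for n
    by metis
  have "\<forall>\<^sub>F x in nhds golden. G (Suc n) x (\<tau> n) < 1 \<and> G n x (\<tau> n) > 1" if "n \<in> {3..N}" for n
    using \<tau> [OF that] that
    by (intro eventually_conj order_tendstoD [OF tendsto_G]) auto
  \<comment> \<open>Each \<open>\<tau> n\<close> was fixed at \<open>golden\<close>, independently
    of \<open>x\<close>, and only finitely many \<open>n\<close> occur, so one neighbourhood serves
    all.\<close>
  then have "\<forall>\<^sub>F x in nhds golden. \<forall>n\<in>{3..N}. G (Suc n) x (\<tau> n) < 1 \<and> G n x (\<tau> n) > 1"
    by (intro eventually_ball_finite) auto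
  with eventually_cond_W_golden [OF assms]
  have "\<forall>\<^sub>F x in nhds golden. (\<forall>p q. ln (real q) / ln (real p) = x \<longrightarrow> cond_W N p q) \<and>
      (\<forall>n\<in>{3..N}. G (Suc n) x (\<tau> n) < 1 \<and> G n x (\<tau> n) > 1)"
    by (rule eventually_conj)
  then obtain \<delta> where \<delta>: "\<delta> > 0" and near: "\<And>x. \<bar>x - golden\<bar> < \<delta> \<Longrightarrow>
      (\<forall>p q. ln (real q) / ln (real p) = x \<longrightarrow> cond_W N p q) \<and>
      (\<forall>n\<in>{3..N}. G (Suc n) x (\<tau> n) < 1 \<and> G n x (\<tau> n) > 1)"
    unfolding eventually_nhds_metric dist_real_def by blast
  have "compatible N p q"
    if pq: "prime p" "prime q" and d: "\<bar>ln (real q) / ln (real p) - golden\<bar> < \<delta>" for p q :: nat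
  proof -
    define x where "x = ln (real q) / ln (real p)"
    have W: "cond_W N p q" using near [OF d] by blast
    have x0: "x \<ge> 0" using cond_W_bounds [OF assms W] by (simp add: x_def)
    have "t_exp p q (n + 1) < t_exp p q n" if n: "n \<in> {3..N}" for n
    proof -
      have G: "G (Suc n) x (\<tau> n) < 1" "G n x (\<tau> n) > 1" using near [OF d] n by (auto simp: x_def)
      have "G (Suc n) x (t_exp p q (Suc n)) = 1" "G n x (t_exp p q n) = 1"
        using n G_t_exp [OF pq assms W] by (auto simp: x_def)
      \<comment> \<open>The reverse order of either pair would, by \<open>G_antimono\<close>,
        contradict the strict inequality at \<open>\<tau> n\<close>.\<close>
      then have "t_exp p q (Suc n) < \<tau> n" "\<tau> n < t_exp p q n"
        using G n G_antimono [of "Suc n" x "\<tau> n" "t_exp p q (Suc n)"]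
          G_antimono [of n x "t_exp p q n" "\<tau> n"] x0 by (auto simp flip: not_le)
      then show ?thesis by simp
    qed
    then show ?thesis using pq W by (simp add: compatible_def)
  qed
  then show ?thesis using \<delta> unfolding golden_def by blast
qed

end
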